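(* Let $\mathcal{N}=\{d^{-1}|\phi_j\rangle\langle\phi_j|\}_{j=1}^{d^2}$ be a SIC-POVM in a $d$-dimensional complex Hilbert space $\mathcal{H}$. For $\alpha\in(0,2]$, $\eta\in[0,1]$, and each density matrix $\rho$ on $\mathcal{H}$, $$H_\alpha^{(\eta)}(\mathcal{N}|\rho)\;\ge\;\eta^\alpha\,\ln_\alpha\!\left(\frac{d(d+1)}{\mathrm{tr}(\rho^2)+1}\right)+h_\alpha(\eta).$$
   Context: A density matrix on $\mathcal{H}$ is a positive semidefinite operator of trace $1$. A SIC-POVM (symmetric informationally complete POVM) in $d$-dimensional $\mathcal{H}$ is a set of $d^2$ operators $d^{-1}|\phi_j\rangle\langle\phi_j|$, $j=1,\ldots,d^2$, with unit vectors $|\phi_j\rangle$ satisfying $|\langle\phi_j|\phi_k\rangle|^2=\frac{1}{d+1}$ for all $j\ne k$ and the completeness relation $\frac1d\sum_{j=1}^{d^2}|\phi_j\rangle\langle\phi_j|=\mathbf{1}$ (identity operator). For $x>0$ and $\alpha>0$, $\alpha\ne1$, $\ln_\alpha(x)=\frac{x^{1-\alpha}-1}{1-\alpha}$, and $\ln_1(x)=\ln x$. For a probability distribution $p=\{p_j\}$, the Tsallis $\alpha$-entropy is $H_\alpha(p)=\frac{1}{1-\alpha}\bigl(\sum_j p_j^\alpha-1\bigr)$ for $\alpha>0$, $\alpha\neq 1$, and $H_1(p)=-\sum_j p_j\ln p_j$ (with $0\ln 0=0$). The binary Tsallis entropy is $h_\alpha(\eta)=-\eta^\alpha\ln_\alpha(\eta)-(1-\eta)^\alpha\ln_\alpha(1-\eta)$,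 i.e. $H_\alpha$ of the two-point distribution $(\eta,1-\eta)$ (terms with argument $0$ are taken to be $0$). Model of detection inefficiency: $H_\alpha^{(\eta)}(\mathcal{N}|\rho)$ denotes $H_\alpha$ of the distribution on $d^2+1$ outcomes $p_j^{(\eta)}=\eta\,d^{-1}\langle\phi_j|\rho|\phi_j\rangle$ ($j=1,\ldots,d^2$), $p_\varnothing^{(\eta)}=1-\eta$. *)

theory Defs
  imports "HOL-Analysis.Analysis"
begin

text \<open>
  The \<open>d\<close>-dimensional complex Hilbert space is \<open>complex ^ 'n\<close> with \<open>d = CARD('n)\<close>; operators
  are square matrices over the same index type. The library norm on \<open>complex ^ 'n\<close> is the
  one induced by the inner product below, which is antilinear in its first argument.
\<close>

definition braket :: "complex ^ 'n \<Rightarrow> complex ^ 'n \<Rightarrow> complex" where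
  "braket x y = (\<Sum>i\<in>UNIV. cnj (x $ i) * y $ i)"

definition ketbra :: "complex ^ 'n \<Rightarrow> complex ^ 'n \<Rightarrow> complex ^ 'n ^ 'n" where
  "ketbra x y = (\<chi> i j. x $ i * cnj (y $ j))"

definition hermitian :: "complex ^ 'n ^ 'n \<Rightarrow> bool" where
  "hermitian A \<longleftrightarrow> (\<forall>i j. A $ i $ j = cnj (A $ j $ i))"

definition positive_semidefinite :: "complex ^ 'n ^ 'n \<Rightarrow> bool" where
  "positive_semidefinite A \<longleftrightarrow> hermitian A \<and> (\<forall>x. 0 \<le> Re (braket x (A *v x)))"

definition density_matrix :: "complex ^ 'n ^ 'n \<Rightarrow> bool" where
  "density_matrix \<rho> \<longleftrightarrow> positive_semidefinite \<rho> \<and> trace \<rho> = 1"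

definition sic_element :: "(nat \<Rightarrow> complex ^ 'n) \<Rightarrow> nat \<Rightarrow> complex ^ 'n ^ 'n" where
  "sic_element \<phi> j = (1 / real CARD('n)) *\<^sub>R ketbra (\<phi> j) (\<phi> j)"

text \<open>Only the values of \<open>\<phi>\<close> on \<open>{1..d^2}\<close> are relevant.\<close>

definition sic_povm :: "(nat \<Rightarrow> complex ^ 'n) \<Rightarrow> bool" where
  "sic_povm \<phi> \<longleftrightarrow>
     (\<forall>j\<in>{1..CARD('n)\<^sup>2}. norm (\<phi> j) = 1) \<and>
     (\<forall>j\<in>{1..CARD('n)\<^sup>2}. \<forall>k\<in>{1..CARD('n)\<^sup>2}. j \<noteq> k \<longrightarrow>
        (cmod (braket (\<phi> j) (\<phi> k)))\<^sup>2 = 1 / (real CARD('n) + 1)) \<and>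
     (\<Sum>j = 1..CARD('n)\<^sup>2. sic_element \<phi> j) = mat 1"

definition tsallis_ln :: "real \<Rightarrow> real \<Rightarrow> real" where
  "tsallis_ln \<alpha> x =
     (if \<alpha> = 1 then ln x else (x powr (1 - \<alpha>) - 1) / (1 - \<alpha>))"

text \<open>
  The conventions for zero arguments hold because \<open>0 powr a = 0\<close> for every \<open>a\<close>, so that zero
  probabilities contribute nothing in the two definitions below (and \<open>0 * ln 0 = 0\<close>).
\<close>

definition tsallis_entropy :: "real \<Rightarrow> 'a set \<Rightarrow> ('a \<Rightarrow> real) \<Rightarrow> real" where
  "tsallis_entropy \<alpha> J p =
     (if \<alpha> = 1 then - (\<Sum>j\<in>J. p j * ln (p j))
      else 1 / (1 - \<alpha>) * ((\<Sum>j\<in>J. p j powr \<alpha>) - 1))"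

definition binary_tsallis_entropy :: "real \<Rightarrow> real \<Rightarrow> real" where
  "binary_tsallis_entropy \<alpha> \<eta> =
     - (\<eta> powr \<alpha>) * tsallis_ln \<alpha> \<eta> - (1 - \<eta>) powr \<alpha> * tsallis_ln \<alpha> (1 - \<eta>)"

text \<open>
  \<open>None\<close> is the no-click outcome. The quadratic form of a density matrix is real-valued,
  so taking the real part only adjusts the type; likewise for the trace of its square.
\<close>

definition inefficient_prob ::
  "real \<Rightarrow> (nat \<Rightarrow> complex ^ 'n) \<Rightarrow> complex ^ 'n ^ 'n \<Rightarrow> nat option \<Rightarrow> real" where
  "inefficient_prob \<eta> \<phi> \<rho> k =
     (case k of
        None \<Rightarrow> 1 - \<eta>
      | Some j \<Rightarrow> \<eta> * (1 / real CARD('n)) * Re (braket (\<phi> j) (\<rho> *v \<phi> j)))"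

definition inefficient_entropy ::
  "real \<Rightarrow> real \<Rightarrow> (nat \<Rightarrow> complex ^ 'n) \<Rightarrow> complex ^ 'n ^ 'n \<Rightarrow> real" where
  "inefficient_entropy \<alpha> \<eta> \<phi> \<rho> =
     tsallis_entropy \<alpha> (insert None (Some ` {1..CARD('n)\<^sup>2})) (inefficient_prob \<eta> \<phi> \<rho>)"

definition purity :: "complex ^ 'n ^ 'n \<Rightarrow> real" where
  "purity \<rho> = Re (trace (\<rho> ** \<rho>))"

end

theory Submission
  imports Defs
begin

text \<open>
  Equip operators with the real inner product \<open>Re (tr (A\<^sup>* B))\<close>. The squared norm of
  \<open>\<rho> - (\<Sum>j. a j *\<^sub>R P j)\<close>, where \<open>P j\<close> are the SIC projectors with Gram matrix
  \<open>(d * \<delta> j k + 1) / (d + 1)\<close> and \<open>a j = ((d + 1) * \<langle>\<rho>, P j\<rangle> - 1) / d\<close>, is nonnegative; this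
  bounds the index of coincidence \<open>\<Sum>j. (p j)\<^sup>2\<close> by \<open>(tr (\<rho>\<^sup>2) + 1) / (d * (d + 1))\<close>.
  Convexity of \<open>\<lambda>x. ln\<^sub>\<alpha> (1 / x)\<close> for \<open>\<alpha> \<le> 2\<close> turns this into the entropy bound at
  \<open>\<eta> = 1\<close>, and the Tsallis entropy splits as \<open>\<eta>\<^sup>\<alpha> H\<^sub>\<alpha>(p) + h\<^sub>\<alpha>(\<eta>)\<close> in general.
\<close>

section \<open>Operators as a real inner product space\<close>

lemma ketbra_matrix_inner:
  "A \<bullet> ketbra x x = Re (braket x (A *v x))" if "hermitian A" for A :: "complex ^ 'n ^ 'n"
proof -
  have "Re (braket x (A *v x)) = (\<Sum>i\<in>UNIV. \<Sum>j\<in>UNIV. Re (cnj (x $ i) * (A $ i $ j * x $ j)))"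
    by (simp add: braket_def matrix_vector_mult_def sum_distrib_left)
  \<comment> \<open>Hermiticity turns \<open>A $ i $ j\<close> into the conjugate of
    \<open>A $ j $ i\<close>, so the entries are matched with their indices transposed.\<close>
  also have "\<dots> = (\<Sum>j\<in>UNIV. \<Sum>i\<in>UNIV. Re (cnj (x $ i) * (A $ i $ j * x $ j)))"
    by (rule sum.swap)
  also have "\<dots> = A \<bullet> ketbra x x"
  proof -
    have "Re (cnj (x $ i) * (A $ i $ j * x $ j)) = A $ j $ i \<bullet> (x $ j * cnj (x $ i))" for i j
    proof -
      have "A $ i $ j = cnj (A $ j $ i)"
        using that by (metis hermitian_def)
      then show ?thesis
        by (simp add: inner_complex_def algebra_simps)
    qed
    then show ?thesis
      by (simp add: inner_vec_def ketbra_def)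
  qed
  finally show ?thesis ..
qed

lemma hermitian_ketbra: "hermitian (ketbra x x)"
  by (simp add: hermitian_def ketbra_def)

text \<open>Turns the overlap condition of a SIC-POVM into the Gram matrix of its
  projectors.\<close>

lemma ketbra_inner_ketbra:
  "ketbra x x \<bullet> ketbra y y = (cmod (braket x y))\<^sup>2"
proof -
  have "ketbra x x *v y = (\<chi> i. x $ i * braket x y)"
    by (simp add: vec_eq_iff braket_def ketbra_def matrix_vector_mult_def sum_distrib_left
        mult.assoc)
  then have "braket y (ketbra x x *v y) = cnj (braket x y) * braket x y"
    by (simp add: braket_def sum_distrib_right algebra_simps)
  then show ?thesis
    by (simp add: ketbra_matrix_inner[OF hermitian_ketbra] mult.commute[of "cnj _"]
        complex_norm_square[symmetric] flip: of_real_power)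
qed

lemma braket_self: "braket x x = of_real ((norm x)\<^sup>2)"
  by (simp add: braket_def norm_vec_def L2_set_def sum_nonneg mult.commute flip: complex_norm_square)

lemma purity_hermitian:
  "purity A = A \<bullet> A" if "hermitian A"
proof -
  have "A $ i $ j * A $ j $ i = of_real ((cmod (A $ i $ j))\<^sup>2)" for i j
    using that unfolding hermitian_def by (metis complex_norm_square)
  then show ?thesis
    by (simp add: purity_def trace_def matrix_matrix_mult_def inner_vec_def
        power2_norm_eq_inner[symmetric])
qed

lemma inner_mat_1: "A \<bullet> mat 1 = Re (trace A)" for A :: "complex ^ 'n ^ 'n"
proof -
  have "A $ i $ j \<bullet> (if i = j then 1 else 0) = (if i = j then Re (A $ i $ i) else 0)" for i j
    by (simp add: inner_complex_def)
  then show ?thesis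
    by (simp add: trace_def mat_def inner_vec_def)
qed

section \<open>Vectors with an equiangular Gram matrix\<close>

lemma equiangular_coincidence_bound:
  fixes v :: "'i \<Rightarrow> 'a :: real_inner" and w :: 'a and d :: real
  assumes "finite J" "d > 0" "real (card J) = d\<^sup>2"
    and unit: "\<And>j. j \<in> J \<Longrightarrow> v j \<bullet> v j = 1"
    and angle: "\<And>j k. j \<in> J \<Longrightarrow> k \<in> J \<Longrightarrow> j \<noteq> k \<Longrightarrow> v j \<bullet> v k = 1 / (d + 1)"
    and total: "(\<Sum>j\<in>J. w \<bullet> v j) = d"
  shows "(\<Sum>j\<in>J. (w \<bullet> v j)\<^sup>2) \<le> d * (w \<bullet> w + 1) / (d + 1)"
proof -
  define q where "q j = w \<bullet> v j" for j
  define S where "S = (\<Sum>j\<in>J. (q j)\<^sup>2)"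
  \<comment> \<open>These coefficients sum to 1 and solve the normal equations
    \<open>(1 + d * a j) / (d + 1) = q j\<close>; hence \<open>u\<close> is the orthogonal
    projection of \<open>w\<close> onto the span of the \<open>v j\<close>.\<close>
  define a where "a j = ((d + 1) * q j - 1) / d" for j
  define u where "u = (\<Sum>j\<in>J. a j *\<^sub>R v j)"
  have sq: "sum q J = d"
    using total by (simp add: q_def)
  have sa: "sum a J = 1"
  proof -
    have "sum a J = ((d + 1) * sum q J - d\<^sup>2) / d"
      using assms(3)
      by (simp add: a_def sum_subtractf flip: sum_divide_distrib sum_distrib_left)
    then show ?thesis
      using assms(2) sq by (simp add: field_simps power2_eq_square)
  qed
  have wu: "w \<bullet> u = (d + 1) * S / d - 1"
  proof -
    have "w \<bullet> u = (\<Sum>j\<in>J. (d + 1) / d * (q j)\<^sup>2 - q j / d)"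
      using assms(2) unfolding u_def inner_sum_right
      by (intro sum.cong) (simp_all add: a_def q_def field_simps power2_eq_square)
    also have "\<dots> = (d + 1) / d * S - sum q J / d"
      by (simp add: sum_subtractf S_def sum_distrib_left sum_divide_distrib)
    finally show ?thesis
      using assms(2) sq by simp
  qed
  have vu: "v j \<bullet> u = q j" if "j \<in> J" for j
  proof -
    \<comment> \<open>Every Gram entry is \<open>1 / (d + 1)\<close>, with an excess of
      \<open>d / (d + 1)\<close> on the diagonal that the conditional term collects.\<close>
    have "v j \<bullet> u = (\<Sum>k\<in>J. a k / (d + 1) + (if k = j then d / (d + 1) * a j else 0))"
      unfolding u_def inner_sum_right
    proof (intro sum.cong refl)
      fix k assume "k \<in> J"
    have "d + 1 \<noteq> 0"
      using assms(2) by simp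
    then have "a j / (d + 1) + d / (d + 1) * a j = a j"
      by (simp add: divide_simps) (simp add: algebra_simps)
    then       show "v j \<bullet> a k *\<^sub>R v k = a k / (d + 1) + (if k = j then d / (d + 1) * a j else 0)"
      using unit[OF that] angle[OF that \<open>k \<in> J\<close>] by (cases "k = j") auto
    qed
    also have "\<dots> = sum a J / (d + 1) + d / (d + 1) * a j"
      using assms(1) that by (simp add: sum.distrib sum_divide_distrib)
    also have "\<dots> = (1 + d * a j) / (d + 1)"
      using sa by (simp add: add_divide_distrib)
    also have "\<dots> = q j"
      using assms(2) by (simp add: a_def)
    finally show ?thesis .
  qed
  \<comment> \<open>By \<open>vu\<close>, \<open>w - u\<close> is orthogonal to every
    \<open>v j\<close> and so to \<open>u\<close>; its squared norm is then given by
    Pythagoras.\<close>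
  have "u \<bullet> u = (\<Sum>j\<in>J. a j * (v j \<bullet> u))"
    by (subst (1) u_def) (simp add: inner_sum_left)
  also have "\<dots> = w \<bullet> u"
    using vu by (simp add: u_def inner_sum_right q_def)
  finally have "(w - u) \<bullet> (w - u) = w \<bullet> w - w \<bullet> u"
    by (simp add: inner_diff_left inner_diff_right inner_commute)
  then have "(d + 1) * S / d - 1 \<le> w \<bullet> w"
    using wu inner_ge_zero[of "w - u"] by simp
  then show ?thesis
    using assms(2) by (simp add: S_def q_def field_simps)
qed

section \<open>The Tsallis logarithm\<close>

lemma tsallis_ln_mono:
  assumes "0 < x" "x \<le> y"
  shows "tsallis_ln \<alpha> x \<le> tsallis_ln \<alpha> y"
proof (cases \<alpha> "1 :: real" rule: linorder_cases)
  case less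
  then show ?thesis
    using assms by (simp add: tsallis_ln_def divide_right_mono powr_mono2)
next
  case equal
  then show ?thesis
    using assms by (simp add: tsallis_ln_def)
next
  case greater
  then have "y powr (1 - \<alpha>) \<le> x powr (1 - \<alpha>)"
    using assms by (intro powr_mono2') auto
  then show ?thesis
    using greater by (simp add: tsallis_ln_def divide_right_mono_neg)
qed

text \<open>Additivity holds up to a power of the first factor. This rescaling law carries a tangent
  inequality from the point 1 to any positive point.\<close>

lemma tsallis_ln_mult:
  assumes "0 < x" "0 < y"
  shows "tsallis_ln \<alpha> (x * y) = tsallis_ln \<alpha> x + x powr (1 - \<alpha>) * tsallis_ln \<alpha> y"
proof (cases "\<alpha> = 1")
  case True
  then show ?thesis
    using assms by (simp add: tsallis_ln_def ln_mult)
next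
  case False
  then show ?thesis
    using assms by (simp add: tsallis_ln_def powr_mult divide_simps) (simp add: algebra_simps)
qed

text \<open>The left side is the tangent at \<open>t = 1\<close> of a convex function: the second
  derivative of the right side in \<open>t\<close> is
  \<open>(2 - \<alpha>) * t powr (\<alpha> - 3)\<close>. This is where \<alpha> \<le> 2
  enters.\<close>

lemma tsallis_ln_inverse_ge:
  assumes "0 < t" "\<alpha> \<le> 2"
  shows "1 - t \<le> tsallis_ln \<alpha> (1 / t)"
proof (cases \<alpha> "1 :: real" rule: linorder_cases)
  case less
  \<comment> \<open>The negative factor \<open>\<alpha> - 1\<close> reverses
    \<open>ln t \<le> t - 1\<close>; with \<open>1 + x \<le> exp x\<close> this yields Bernoulli's
    inequality for a negative exponent.\<close>
  have "1 + (\<alpha> - 1) * (t - 1) \<le> 1 + (\<alpha> - 1) * ln t"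
    using less assms ln_le_minus_one[of t] by (simp add: mult_left_mono_neg)
  also have "\<dots> \<le> t powr (\<alpha> - 1)"
    using assms exp_ge_add_one_self[of "(\<alpha> - 1) * ln t"] by (simp add: powr_def)
  also have "\<dots> = (1 / t) powr (1 - \<alpha>)"
    using assms by (simp add: powr_divide flip: powr_minus_divide)
  finally show ?thesis
    using less by (simp add: tsallis_ln_def field_simps)
next
  case equal
  then show ?thesis
    using assms ln_le_minus_one[of t] by (simp add: tsallis_ln_def ln_div)
next
  case greater
  have "(1 / t) powr (1 - \<alpha>) = t powr (\<alpha> - 1)"
    using assms by (simp add: powr_divide flip: powr_minus_divide)
  \<comment> \<open>Weighted AM-GM for \<open>t\<close> and 1 with weights
    \<open>\<alpha> - 1\<close> and \<open>2 - \<alpha>\<close>.\<close>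
  also have "\<dots> \<le> (\<alpha> - 1) * t + (2 - \<alpha>)"
    using Youngs_inequality_0[of "\<alpha> - 1" "2 - \<alpha>" t 1] greater assms by simp
  finally show ?thesis
    using greater by (simp add: tsallis_ln_def field_simps)
qed

section \<open>Tsallis entropy of finite distributions\<close>

lemma powr_mult_powr_one_minus: "x powr \<alpha> * x powr (1 - \<alpha>) = x" if "0 \<le> x" for x :: real
  using that by (simp flip: powr_add)

text \<open>Writes the entropy as a mean with weights \<open>p j\<close>, the form to which Jensen's
  inequality applies.\<close>

lemma tsallis_entropy_eq_sum_tsallis_ln:
  assumes "\<And>j. j \<in> J \<Longrightarrow> p j \<ge> 0" "sum p J = 1"
  shows "tsallis_entropy \<alpha> J p = (\<Sum>j\<in>J. p j * tsallis_ln \<alpha> (1 / p j))"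
proof (cases "\<alpha> = 1")
  case True
  have "p j * ln (1 / p j) = - (p j * ln (p j))" if "j \<in> J" for j
    using assms(1)[OF that] by (cases "p j = 0") (simp_all add: ln_div)
  then show ?thesis
    using True by (simp add: tsallis_entropy_def tsallis_ln_def sum_negf)
next
  case False
  have "p j * tsallis_ln \<alpha> (1 / p j) = (p j powr \<alpha> - p j) / (1 - \<alpha>)" if "j \<in> J" for j
  proof (cases "p j = 0")
    case False
    then have "p j > 0"
      using assms(1)[OF that] by simp
    then have "p j * (1 / p j) powr (1 - \<alpha>) = p j powr \<alpha>"
      by (simp add: powr_divide powr_diff)
    then show ?thesis
      using \<open>\<alpha> \<noteq> 1\<close> by (simp add: tsallis_ln_def right_diff_distrib)
  qed simp
  then have "(\<Sum>j\<in>J. p j * tsallis_ln \<alpha> (1 / p j)) = (\<Sum>j\<in>J. (p j powr \<alpha> - p j) / (1 - \<alpha>))"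
    by (rule sum.cong[OF refl])
  also have "\<dots> = ((\<Sum>j\<in>J. p j powr \<alpha>) - 1) / (1 - \<alpha>)"
    using assms(2) by (simp add: sum_subtractf flip: sum_divide_distrib)
  finally show ?thesis
    using False by (simp add: tsallis_entropy_def)
qed

text \<open>Jensen's inequality for the convex function \<open>tsallis_ln \<alpha> (1 / t)\<close>
  at the points \<open>p j\<close> with weights \<open>p j\<close>: their mean is
  \<open>C\<close>.\<close>

lemma tsallis_entropy_ge_ln_inverse_coincidence:
  fixes p :: "'i \<Rightarrow> real"
  assumes "finite J" "\<And>j. j \<in> J \<Longrightarrow> p j \<ge> 0" "sum p J = 1" "\<alpha> \<le> 2"
  defines "C \<equiv> \<Sum>j\<in>J. (p j)\<^sup>2"
  shows "C > 0" and "tsallis_ln \<alpha> (1 / C) \<le> tsallis_entropy \<alpha> J p"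
proof -
  obtain j where "j \<in> J" "p j \<noteq> 0"
    using assms(3) by (metis sum.neutral zero_neq_one)
  then show "C > 0"
    unfolding C_def using assms(1) by (intro sum_pos2[of J j]) auto
  let ?c = "(1 / C) powr (1 - \<alpha>)"
  \<comment> \<open>The tangent at \<open>C\<close>, rescaled from the one at 1 by factoring
    \<open>1 / p j\<close> as \<open>1 / C\<close> times \<open>C / p j\<close>, then multiplied by
    the weight \<open>p j\<close>.\<close>
  have tangent: "p j * tsallis_ln \<alpha> (1 / C) + ?c * (p j - (p j)\<^sup>2 / C) \<le> p j * tsallis_ln \<alpha> (1 / p j)"
    if "j \<in> J" for j
  proof (cases "p j = 0")
    case False
    then have "p j > 0"
      using assms(2)[OF that] by simp
    have "tsallis_ln \<alpha> (1 / p j) = tsallis_ln \<alpha> (1 / C) + ?c * tsallis_ln \<alpha> (1 / (p j / C))"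
      using tsallis_ln_mult[of "1 / C" "1 / (p j / C)" \<alpha>] \<open>C > 0\<close> \<open>p j > 0\<close> by simp
    also have "\<dots> \<ge> tsallis_ln \<alpha> (1 / C) + ?c * (1 - p j / C)"
      using tsallis_ln_inverse_ge[of "p j / C" \<alpha>] assms(4) \<open>C > 0\<close> \<open>p j > 0\<close>
      by (intro add_left_mono mult_left_mono) auto
    finally have "p j * (tsallis_ln \<alpha> (1 / C) + ?c * (1 - p j / C)) \<le> p j * tsallis_ln \<alpha> (1 / p j)"
      using \<open>p j > 0\<close> by (intro mult_left_mono) auto
    then show ?thesis
      by (simp add: algebra_simps power2_eq_square)
  qed simp
  \<comment> \<open>The added linear term is zero, since \<open>sum p J\<close> and
    \<open>C / C\<close> are both 1.\<close>
  have "tsallis_ln \<alpha> (1 / C) = sum p J * tsallis_ln \<alpha> (1 / C) + ?c * (sum p J - C / C)"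
    using assms(3) \<open>C > 0\<close> by simp
  also have "\<dots> = (\<Sum>j\<in>J. p j * tsallis_ln \<alpha> (1 / C) + ?c * (p j - (p j)\<^sup>2 / C))"
    unfolding C_def
    by (simp add: sum.distrib sum_subtractf flip: sum_distrib_left sum_distrib_right sum_divide_distrib)
  also have "\<dots> \<le> (\<Sum>j\<in>J. p j * tsallis_ln \<alpha> (1 / p j))"
    by (rule sum_mono) (rule tangent)
  also have "\<dots> = tsallis_entropy \<alpha> J p"
    using assms(2,3) by (simp add: tsallis_entropy_eq_sum_tsallis_ln)
  finally show "tsallis_ln \<alpha> (1 / C) \<le> tsallis_entropy \<alpha> J p" .
qed

text \<open>Grouping property: the outcomes refine a binary choice between click and no click, and
  scaling by \<eta> multiplies the power sum of \<open>p\<close> by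
  \<open>\<eta> powr \<alpha>\<close>.\<close>

lemma tsallis_entropy_inefficient:
  fixes p :: "'i \<Rightarrow> real"
  assumes "finite J" "\<And>j. j \<in> J \<Longrightarrow> p j \<ge> 0" "sum p J = 1" "0 \<le> \<eta>" "\<eta> \<le> 1"
  shows "tsallis_entropy \<alpha> (insert None (Some ` J)) (\<lambda>k. case k of None \<Rightarrow> 1 - \<eta> | Some j \<Rightarrow> \<eta> * p j)
    = \<eta> powr \<alpha> * tsallis_entropy \<alpha> J p + binary_tsallis_entropy \<alpha> \<eta>"
proof -
  let ?q = "\<lambda>k. case k of None \<Rightarrow> 1 - \<eta> | Some j \<Rightarrow> \<eta> * p j"
  have split: "(\<Sum>k\<in>insert None (Some ` J). f (?q k)) = f (1 - \<eta>) + (\<Sum>j\<in>J. f (\<eta> * p j))"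
    for f :: "real \<Rightarrow> real"
    using assms(1) by (subst sum.insert) (auto simp: sum.reindex)
  show ?thesis
  proof (cases "\<alpha> = 1")
    case True
    have "\<eta> * p j * ln (\<eta> * p j) = \<eta> * ln \<eta> * p j + \<eta> * (p j * ln (p j))" if "j \<in> J" for j
      using assms(2)[OF that] assms(4) by (cases "\<eta> = 0 \<or> p j = 0") (auto simp: ln_mult algebra_simps)
    then have "(\<Sum>j\<in>J. \<eta> * p j * ln (\<eta> * p j)) = \<eta> * ln \<eta> + \<eta> * (\<Sum>j\<in>J. p j * ln (p j))"
      using assms(3) by (simp add: sum.distrib flip: sum_distrib_left)
    then show ?thesis
      using True assms(4,5) split[of "\<lambda>x. x * ln x"]
      by (simp add: tsallis_entropy_def binary_tsallis_entropy_def tsallis_ln_def)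
  next
    case False
    \<comment> \<open>Brings the binary entropy into power-sum form; the linear terms \<eta> and 1 -
      \<eta> add up to 1.\<close>
    have self_ln: "x powr \<alpha> * tsallis_ln \<alpha> x = (x - x powr \<alpha>) / (1 - \<alpha>)" if "0 \<le> x" for x
      using False powr_mult_powr_one_minus[OF that, of \<alpha>]
      by (simp add: tsallis_ln_def right_diff_distrib)
    have "(\<Sum>j\<in>J. (\<eta> * p j) powr \<alpha>) = \<eta> powr \<alpha> * (\<Sum>j\<in>J. p j powr \<alpha>)"
      using assms(2,4) by (simp add: powr_mult sum_distrib_left)
    moreover have "binary_tsallis_entropy \<alpha> \<eta> = (\<eta> powr \<alpha> + (1 - \<eta>) powr \<alpha> - 1) / (1 - \<alpha>)"
      using assms(4,5) False
      by (simp add: binary_tsallis_entropy_def self_ln) (simp add: divide_simps)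
    ultimately show ?thesis
      using False split[of "\<lambda>x. x powr \<alpha>"]
      by (simp add: tsallis_entropy_def divide_simps) (simp add: algebra_simps)
  qed
qed

section \<open>SIC-POVMs with inefficient detection\<close>

theorem mainTheorem8:
  fixes \<phi> :: "nat \<Rightarrow> complex ^ 'n"
    and \<rho> :: "complex ^ 'n ^ 'n"
    and \<alpha> \<eta> :: real
  assumes "sic_povm \<phi>"
    and "density_matrix \<rho>"
    and "0 < \<alpha>" and "\<alpha> \<le> 2"
    and "0 \<le> \<eta>" and "\<eta> \<le> 1"
  shows "inefficient_entropy \<alpha> \<eta> \<phi> \<rho> \<ge>
           \<eta> powr \<alpha> * tsallis_ln \<alpha> (real CARD('n) * (real CARD('n) + 1) / (purity \<rho> + 1))
           + binary_tsallis_entropy \<alpha> \<eta>"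
proof -
  define d where "d = real CARD('n)"
  define J where "J = {1..CARD('n)\<^sup>2}"
  define P where "P j = ketbra (\<phi> j) (\<phi> j)" for j
  define p where "p j = (\<rho> \<bullet> P j) / d" for j
  define C where "C = (\<Sum>j\<in>J. (p j)\<^sup>2)"
  have "d > 0"
    by (simp add: d_def)
  have herm: "hermitian \<rho>" and pos: "\<And>x. 0 \<le> Re (braket x (\<rho> *v x))" and tr: "trace \<rho> = 1"
    using assms(2) by (auto simp: density_matrix_def positive_semidefinite_def)
  have q_eq: "\<rho> \<bullet> P j = Re (braket (\<phi> j) (\<rho> *v \<phi> j))" for j
    unfolding P_def by (rule ketbra_matrix_inner[OF herm])
  have p_nonneg: "p j \<ge> 0" for j
    using pos[of "\<phi> j"] \<open>d > 0\<close> by (simp add: p_def q_eq)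
  have "(\<Sum>j\<in>J. (1 / d) *\<^sub>R P j) = mat 1"
    using assms(1) by (simp add: sic_povm_def sic_element_def J_def P_def d_def)
  \<comment> \<open>Pairing the completeness relation with \<rho> turns unit trace into
    normalization of \<open>p\<close>.\<close>
  then have "\<rho> \<bullet> (\<Sum>j\<in>J. (1 / d) *\<^sub>R P j) = 1"
    using tr by (simp add: inner_mat_1)
  then have p_sum: "sum p J = 1"
    by (simp add: inner_sum_right p_def)
  have "(\<Sum>j\<in>J. (\<rho> \<bullet> P j)\<^sup>2) \<le> d * (\<rho> \<bullet> \<rho> + 1) / (d + 1)"
  proof (rule equiangular_coincidence_bound)
    show "real (card J) = d\<^sup>2"
      by (simp add: J_def d_def)
    show "P j \<bullet> P j = 1" if "j \<in> J" for j
      using assms(1) that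
      by (simp add: P_def ketbra_inner_ketbra braket_self sic_povm_def J_def)
    show "P j \<bullet> P k = 1 / (d + 1)" if "j \<in> J" "k \<in> J" "j \<noteq> k" for j k
      using assms(1) that by (simp add: P_def ketbra_inner_ketbra sic_povm_def J_def d_def)
    show "(\<Sum>j\<in>J. \<rho> \<bullet> P j) = d"
      using p_sum \<open>d > 0\<close> by (simp add: p_def flip: sum_divide_distrib)
  qed (simp_all add: J_def \<open>d > 0\<close>)
  \<comment> \<open>The factor \<open>d\<^sup>2\<close> comes from \<open>p j\<close> being
    \<open>\<rho> \<bullet> P j\<close> divided by \<open>d\<close>.\<close>
  then have "d\<^sup>2 * C \<le> d * (purity \<rho> + 1) / (d + 1)"
    using \<open>d > 0\<close>
    by (simp add: C_def p_def power_divide purity_hermitian[OF herm] flip: sum_divide_distrib)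
  then have "d * (C * (d * (d + 1))) \<le> d * (purity \<rho> + 1)"
    using \<open>d > 0\<close> by (simp add: field_simps power2_eq_square)
  then have C_le: "C * (d * (d + 1)) \<le> purity \<rho> + 1"
    using \<open>d > 0\<close> by simp
  have ent: "C > 0" "tsallis_ln \<alpha> (1 / C) \<le> tsallis_entropy \<alpha> J p"
    using tsallis_entropy_ge_ln_inverse_coincidence[of J p \<alpha>] p_nonneg p_sum assms(4)
    by (simp_all add: C_def J_def)
  have "purity \<rho> + 1 > 0"
    using inner_ge_zero[of \<rho>] unfolding purity_hermitian[OF herm] by linarith
  \<comment> \<open>Inverting the upper bound on \<open>C\<close> gives a lower bound on
    \<open>1 / C\<close>, which the increasing Tsallis logarithm preserves.\<close>
  then have "0 < d * (d + 1) / (purity \<rho> + 1)" "d * (d + 1) / (purity \<rho> + 1) \<le> 1 / C"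
    using C_le \<open>C > 0\<close> \<open>d > 0\<close> by (simp_all add: divide_le_eq le_divide_eq mult.commute)
  then have "tsallis_ln \<alpha> (d * (d + 1) / (purity \<rho> + 1)) \<le> tsallis_ln \<alpha> (1 / C)"
    by (rule tsallis_ln_mono)
  then have "\<eta> powr \<alpha> * tsallis_ln \<alpha> (d * (d + 1) / (purity \<rho> + 1))
      \<le> \<eta> powr \<alpha> * tsallis_entropy \<alpha> J p"
    using ent(2) by (intro mult_left_mono) auto
  moreover have "inefficient_prob \<eta> \<phi> \<rho> = (\<lambda>k. case k of None \<Rightarrow> 1 - \<eta> | Some j \<Rightarrow> \<eta> * p j)"
    by (auto simp: inefficient_prob_def p_def q_eq d_def split: option.splits)
  ultimately show ?thesis
    using tsallis_entropy_inefficient[of J p \<eta> \<alpha>] p_nonneg p_sum assms(5,6)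
    by (simp add: inefficient_entropy_def J_def d_def)
qed

end
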